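(* Let $A$ be a symmetric real $p\times p$ matrix, $B$ a symmetric positive definite real $p\times p$ matrix, and $1\le k<p$. Let $(V^\ast,\rho^\ast)$ be the solution of the trace ratio problem for $(A,B)$, with $(A-\rho^\ast B)V^\ast = V^\ast\Lambda^\ast$, and assume $\lambda_k(A-\rho^\ast B)>\lambda_{k+1}(A-\rho^\ast B)$. Let $k\le j\le p$, let $U$ be a $p\times j$ matrix with orthonormal columns, $\mathcal U = \operatorname{span}(U)$, and let $\rho$ be the maximum value of the trace ratio problem projected onto $\mathcal U$. Let $U_\perp$ be a $p\times(p-j)$ matrix whose columns form an orthonormal basis of the orthogonal complement of $\mathcal U$, and decompose \[ V^\ast = UU^TV^\ast + U_\perp U_\perp^TV^\ast =: UE + U_\perp F , \] so that $E=U^TV^\ast$ is $j\times k$ and $F=U_\perp^TV^\ast$. Let $H = U^TAU$, $K = U^TBU$, let $\sin\theta = \|U_\perp^TV^\ast\|$, and assume $\sin\theta<1$. Define the $j\times k$ matrix $\widehat E = E(E^TE)^{-1/2}$, which has orthonormal columns. Then the matrix \[ G = \big[(\rho-\rho^\ast)\,K\widehat E + U^T(A-\rho^\ast B)\,U_\perp F\,(E^TE)^{-1/2}\big]\,\widehat E^T \] satisfies \[ \|G\|\le (\rho^\ast-\rho)\,\|B\| + \frac{\sin\theta}{\sqrt{1-\sin^2\theta}}\,\|A-\rho^\ast B\|, \] and $\big((E^TE)^{1/2}\Lambda^\ast(E^TE)^{-1/2},\ \widehat E\big)$ is an eigenblock of $H-\rho K+G$, i.e. \[ (H-\rho K+G)\,\widehat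 E = \widehat E\,(E^TE)^{1/2}\Lambda^\ast(E^TE)^{-1/2}, \] where $(E^TE)^{1/2}\Lambda^\ast(E^TE)^{-1/2}$ has the same eigenvalues as $\Lambda^\ast$.
   Context: The trace ratio problem for $(A,B)$ is $\max_{V\in\mathbb R^{p\times k},\,V^TV=I_k}\rho(V)$, with $\rho(V)=\operatorname{tr}(V^TAV)/\operatorname{tr}(V^TBV)$; its solution $(V^\ast,\rho^\ast)$ consists of a maximizer $V^\ast$ ($p\times k$, orthonormal columns) and the maximum value $\rho^\ast$. It is known that the columns of $V^\ast$ form an orthonormal basis of the eigenspace of $A-\rho^\ast B$ associated with its $k$ largest eigenvalues, so $\Lambda^\ast=(V^\ast)^T(A-\rho^\ast B)V^\ast$ is $k\times k$ with eigenvalues $\lambda_1(A-\rho^\ast B),\dots,\lambda_k(A-\rho^\ast B)$. Eigenvalues of a symmetric $p\times p$ matrix $S$ are ordered $\lambda_1(S)\ge\dots\ge\lambda_p(S)$. The trace ratio problem projected onto $\mathcal U=\operatorname{span}(U)$ is $\rho=\max_{V=UZ,\ V^TV=I_k}\rho(V) = \max_{Z\in\mathbb R^{j\times k},\,Z^TZ=I_k}\operatorname{tr}(Z^TU^TAUZ)/\operatorname{tr}(Z^TU^TBUZ)$. $\|\cdot\|$ is the spectral norm (if $j=p$, terms involving the empty matrix $U_\perp$ are zero). *)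

theory Defs
  imports
    Complex_Main
    "Jordan_Normal_Form.Char_Poly"
    "Jordan_Normal_Form.Gauss_Jordan_Elimination"
    "Jordan_Normal_Form.VS_Connect"
begin

definition sym_mat :: "nat \<Rightarrow> real mat \<Rightarrow> bool" where
  "sym_mat n M \<longleftrightarrow> M \<in> carrier_mat n n \<and> M\<^sup>T = M"

definition pos_semidef_mat :: "nat \<Rightarrow> real mat \<Rightarrow> bool" where
  "pos_semidef_mat n M \<longleftrightarrow>
     sym_mat n M \<and> (\<forall>x \<in> carrier_vec n. x \<bullet> (M *\<^sub>v x) \<ge> 0)"

definition pos_def_mat :: "nat \<Rightarrow> real mat \<Rightarrow> bool" where
  "pos_def_mat n M \<longleftrightarrow>
     sym_mat n M \<and> (\<forall>x \<in> carrier_vec n. x \<noteq> 0\<^sub>v n \<longrightarrow> x \<bullet> (M *\<^sub>v x) > 0)"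

definition tr :: "real mat \<Rightarrow> real" where
  "tr M = (\<Sum>i < dim_row M. M $$ (i, i))"

definition vec_norm2 :: "real vec \<Rightarrow> real" where
  "vec_norm2 x = sqrt (x \<bullet> x)"

text \<open>Taking the supremum over the unit ball instead of the unit sphere makes the norm
  of a matrix without rows or without columns equal to 0.\<close>

definition spectral_norm :: "real mat \<Rightarrow> real" where
  "spectral_norm M =
     (SUP x \<in> {x \<in> carrier_vec (dim_col M). vec_norm2 x \<le> 1}. vec_norm2 (M *\<^sub>v x))"

definition eigvals :: "'a :: field mat \<Rightarrow> 'a multiset" where
  "eigvals M = proots (char_poly M)"

text \<open>The eigenvalues of a symmetric real matrix in decreasing order and with multiplicity;
  the index \<open>i\<close> is counted from 1.\<close>

definition eig :: "nat \<Rightarrow> real mat \<Rightarrow> real" where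
  "eig i S = rev (sorted_list_of_multiset (eigvals S)) ! (i - 1)"

text \<open>The principal square root, meaningful for positive semidefinite matrices.\<close>

definition mat_sqrt :: "real mat \<Rightarrow> real mat" where
  "mat_sqrt M = (THE R. pos_semidef_mat (dim_row M) R \<and> R * R = M)"

text \<open>Meaningful for positive definite matrices.\<close>

definition mat_inv_sqrt :: "real mat \<Rightarrow> real mat" where
  "mat_inv_sqrt M = the (mat_inverse (mat_sqrt M))"

definition stiefel :: "nat \<Rightarrow> nat \<Rightarrow> real mat set" where
  "stiefel n k = {V \<in> carrier_mat n k. V\<^sup>T * V = 1\<^sub>m k}"

definition trace_ratio :: "real mat \<Rightarrow> real mat \<Rightarrow> real mat \<Rightarrow> real" where
  "trace_ratio A B V = tr (V\<^sup>T * A * V) / tr (V\<^sup>T * B * V)"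

definition trace_ratio_solution ::
    "nat \<Rightarrow> nat \<Rightarrow> real mat \<Rightarrow> real mat \<Rightarrow> real mat \<Rightarrow> real \<Rightarrow> bool" where
  "trace_ratio_solution p k A B V r \<longleftrightarrow>
     is_arg_max (trace_ratio A B) (\<lambda>W. W \<in> stiefel p k) V \<and> r = trace_ratio A B V"

definition projected_trace_ratio_max ::
    "nat \<Rightarrow> nat \<Rightarrow> real mat \<Rightarrow> real mat \<Rightarrow> real mat \<Rightarrow> real \<Rightarrow> bool" where
  "projected_trace_ratio_max p k A B U r \<longleftrightarrow>
     (\<exists>V. is_arg_max (trace_ratio A B)
            (\<lambda>W. W \<in> stiefel p k \<and> (\<exists>Z \<in> carrier_mat (dim_col U) k. W = U * Z)) V
          \<and> r = trace_ratio A B V)"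

end

(* Orthogonality of [U, Uperp] gives |x|^2 = |E x|^2 + |F x|^2, so E^T E is bounded below by
   1 - sin^2 theta > 0; hence its square root is invertible and
   |(E^T E)^{-1/2}| <= 1 / sqrt (1 - sin^2 theta), which yields the norm bound on G.
   Multiplying (A - rho* B) V* = V* Lambda* from the left by U^T gives
   (H - rho* K) E + U^T (A - rho* B) Uperp F = E Lambda*. The matrix G is chosen so that, after
   multiplication from the right by (E^T E)^{-1/2}, it absorbs the second summand and the change
   from rho* to rho. *)

theory Submission
  imports
    Defs
    "HOL-Analysis.L2_Norm"
    "Jordan_Normal_Form.Spectral_Radius"
begin

section \<open>Euclidean and spectral norms\<close>

text \<open>The square root of E^T E is the part that costs work. \<open>mat_sqrt\<close> is a
  definite description, so nothing can be said about \<open>R\<close> and \<open>Ri\<close> before a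
  positive semidefinite root is known to exist and to be unique. Both facts rest on the spectral
  theorem for real symmetric matrices, obtained by deflation: a reflection that carries the first
  unit vector to an eigenvector splits off one eigenvalue, and the remaining block is smaller. The
  angle theta enters only through the number sin theta = |F|, the norm of the part of Vs outside the
  span of U. The first term of the bound carries rho* - rho without absolute value because the
  projected problem maximises the same ratio over fewer matrices.\<close>

lemma scalar_prod_self_nonneg: "0 \<le> (x :: real vec) \<bullet> x"
  by (auto simp: scalar_prod_def intro: sum_nonneg)

lemma scalar_prod_self_eq_0_iff:
  assumes "(x :: real vec) \<in> carrier_vec n"
  shows "x \<bullet> x = 0 \<longleftrightarrow> x = 0\<^sub>v n"
  using conjugate_square_eq_0_vec[OF assms] by simp

lemma vec_norm2_L2_set: "vec_norm2 x = L2_set (($) x) {0..<dim_vec x}"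
  by (simp add: vec_norm2_def L2_set_def scalar_prod_def power2_eq_square)

lemma vec_norm2_nonneg [simp]: "0 \<le> vec_norm2 x"
  by (simp add: vec_norm2_def scalar_prod_self_nonneg)

lemma vec_norm2_sq: "(vec_norm2 x)\<^sup>2 = x \<bullet> x"
  by (simp add: vec_norm2_def scalar_prod_self_nonneg)

lemma vec_norm2_zero [simp]: "vec_norm2 (0\<^sub>v n) = 0"
  by (simp add: vec_norm2_def)

lemma vec_norm2_smult: "vec_norm2 (c \<cdot>\<^sub>v x) = \<bar>c\<bar> * vec_norm2 x"
  by (simp add: vec_norm2_def real_sqrt_mult flip: mult.assoc)

lemma vec_norm2_add:
  assumes "x \<in> carrier_vec n" "y \<in> carrier_vec n"
  shows "vec_norm2 (x + y) \<le> vec_norm2 x + vec_norm2 y"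
proof -
  have "vec_norm2 (x + y) = L2_set (\<lambda>i. x $ i + y $ i) {0..<n}"
    using assms by (auto simp: vec_norm2_L2_set intro: L2_set_cong)
  also have "\<dots> \<le> vec_norm2 x + vec_norm2 y"
    using L2_set_triangle_ineq[of "($) x" "($) y"] assms by (simp add: vec_norm2_L2_set)
  finally show ?thesis .
qed

lemma abs_scalar_prod_le:
  assumes "x \<in> carrier_vec n" "y \<in> carrier_vec n"
  shows "\<bar>x \<bullet> y\<bar> \<le> vec_norm2 x * vec_norm2 y"
proof -
  have "\<bar>x \<bullet> y\<bar> \<le> (\<Sum>i\<in>{0..<n}. \<bar>x $ i\<bar> * \<bar>y $ i\<bar>)"
    using assms sum_abs[of "\<lambda>i. x $ i * y $ i" "{0..<n}"] by (simp add: scalar_prod_def abs_mult)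
  also have "\<dots> \<le> vec_norm2 x * vec_norm2 y"
    using L2_set_mult_ineq[of "($) x" "($) y"] assms by (simp add: vec_norm2_L2_set)
  finally show ?thesis .
qed

text \<open>The supremum in \<open>spectral_norm\<close> yields upper estimates only once it is
  known to be over a bounded set. A crude bound is enough: the Euclidean norm is at most the sum of
  the absolute entries, and Cauchy-Schwarz bounds each entry by the norm of a row.\<close>

lemma bdd_above_spectral_norm:
  "bdd_above ((\<lambda>x. vec_norm2 (M *\<^sub>v x)) ` {x \<in> carrier_vec (dim_col M). vec_norm2 x \<le> 1})"
proof (rule bdd_aboveI2)
  fix x assume x: "x \<in> {x \<in> carrier_vec (dim_col M). vec_norm2 x \<le> 1}"
  have "vec_norm2 (M *\<^sub>v x) \<le> (\<Sum>i\<in>{0..<dim_row M}. \<bar>(M *\<^sub>v x) $ i\<bar>)"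
    unfolding vec_norm2_L2_set dim_mult_mat_vec by (rule L2_set_le_sum_abs)
  also have "\<dots> \<le> (\<Sum>i\<in>{0..<dim_row M}. vec_norm2 (row M i))"
  proof (rule sum_mono)
    fix i assume "i \<in> {0..<dim_row M}"
    then have "\<bar>(M *\<^sub>v x) $ i\<bar> \<le> vec_norm2 (row M i) * vec_norm2 x"
      using abs_scalar_prod_le[of "row M i" "dim_col M" x] x by simp
    also have "\<dots> \<le> vec_norm2 (row M i)"
      using x by (simp add: mult_left_le)
    finally show "\<bar>(M *\<^sub>v x) $ i\<bar> \<le> vec_norm2 (row M i)" .
  qed
  finally show "vec_norm2 (M *\<^sub>v x) \<le> (\<Sum>i\<in>{0..<dim_row M}. vec_norm2 (row M i))" .
qed

lemma spectral_norm_nonneg: "0 \<le> spectral_norm M"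
proof -
  have "vec_norm2 (M *\<^sub>v 0\<^sub>v (dim_col M)) \<le> spectral_norm M"
    unfolding spectral_norm_def by (intro cSUP_upper bdd_above_spectral_norm) auto
  then show ?thesis
    using vec_norm2_nonneg order_trans by blast
qed

lemma vec_norm2_mult_mat_vec_le:
  assumes "x \<in> carrier_vec (dim_col M)"
  shows "vec_norm2 (M *\<^sub>v x) \<le> spectral_norm M * vec_norm2 x"
proof (cases "vec_norm2 x = 0")
  case True
  then have "x = 0\<^sub>v (dim_col M)"
    using scalar_prod_self_eq_0_iff[OF assms] by (simp add: vec_norm2_def)
  then have "M *\<^sub>v x = 0\<^sub>v (dim_row M)"
    by (auto intro!: eq_vecI)
  with True show ?thesis by simp
next
  case False
  let ?c = "inverse (vec_norm2 x)"
  have "vec_norm2 (M *\<^sub>v (?c \<cdot>\<^sub>v x)) \<le> spectral_norm M"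
    unfolding spectral_norm_def
    by (intro cSUP_upper bdd_above_spectral_norm) (use assms False in \<open>auto simp: vec_norm2_smult\<close>)
  moreover have "M *\<^sub>v (?c \<cdot>\<^sub>v x) = ?c \<cdot>\<^sub>v (M *\<^sub>v x)"
    using assms by (intro mult_mat_vec) auto
  ultimately have "?c * vec_norm2 (M *\<^sub>v x) \<le> spectral_norm M"
    by (simp add: vec_norm2_smult)
  then show ?thesis
    using False vec_norm2_nonneg[of x] by (simp add: field_simps)
qed

text \<open>For a matrix without columns the second premise holds for every c while the norm is 0,
  so \<open>0 \<le> c\<close> has to be required separately.\<close>

lemma spectral_norm_le:
  assumes "0 \<le> c" "\<And>x. x \<in> carrier_vec (dim_col M) \<Longrightarrow> vec_norm2 (M *\<^sub>v x) \<le> c * vec_norm2 x"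
  shows "spectral_norm M \<le> c"
  unfolding spectral_norm_def
proof (rule cSUP_least)
  have "0\<^sub>v (dim_col M) \<in> {x \<in> carrier_vec (dim_col M). vec_norm2 x \<le> 1}" by simp
  then show "{x \<in> carrier_vec (dim_col M). vec_norm2 x \<le> 1} \<noteq> {}" by blast
  fix x assume x: "x \<in> {x \<in> carrier_vec (dim_col M). vec_norm2 x \<le> 1}"
  then have "vec_norm2 (M *\<^sub>v x) \<le> c * vec_norm2 x" using assms(2) by simp
  also have "\<dots> \<le> c" using x assms(1) by (simp add: mult_left_le)
  finally show "vec_norm2 (M *\<^sub>v x) \<le> c" .
qed

section \<open>Orthonormal columns: isometry and contraction\<close>

lemma vec_norm2_stiefel:
  assumes "V \<in> stiefel n k" "x \<in> carrier_vec k"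
  shows "vec_norm2 (V *\<^sub>v x) = vec_norm2 x"
proof -
  have V: "V \<in> carrier_mat n k" "V\<^sup>T * V = 1\<^sub>m k"
    using assms by (auto simp: stiefel_def)
  have "(V *\<^sub>v x) \<bullet> (V *\<^sub>v x) = (V\<^sup>T *\<^sub>v (V *\<^sub>v x)) \<bullet> x"
    using V assms transpose_vec_mult_scalar[of V n k x "V *\<^sub>v x"] by simp
  also have "V\<^sup>T *\<^sub>v (V *\<^sub>v x) = x"
    using V assms by (simp flip: assoc_mult_mat_vec[of "V\<^sup>T" k n V k x])
  finally show ?thesis by (simp add: vec_norm2_def)
qed

text \<open>With y = V^T x, moving V across the scalar product and Cauchy-Schwarz give |y|^2 = x . V
  y <= |x| |V y| = |x| |y|; then |y| cancels unless it is 0.\<close>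

lemma vec_norm2_stiefel_transpose:
  assumes "V \<in> stiefel n k" "x \<in> carrier_vec n"
  shows "vec_norm2 (V\<^sup>T *\<^sub>v x) \<le> vec_norm2 x"
proof -
  let ?y = "V\<^sup>T *\<^sub>v x"
  have V: "V \<in> carrier_mat n k" using assms by (auto simp: stiefel_def)
  have "(vec_norm2 ?y)\<^sup>2 = x \<bullet> (V *\<^sub>v ?y)"
    using V assms transpose_vec_mult_scalar[of V n k ?y x] by (simp add: vec_norm2_sq)
  also have "\<dots> \<le> vec_norm2 x * vec_norm2 (V *\<^sub>v ?y)"
    using abs_scalar_prod_le[of x n "V *\<^sub>v ?y"] V assms by fastforce
  also have "vec_norm2 (V *\<^sub>v ?y) = vec_norm2 ?y"
    using vec_norm2_stiefel[OF assms(1), of ?y] V assms by simp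
  finally show ?thesis
    using vec_norm2_nonneg[of ?y] vec_norm2_nonneg[of x]
    by (cases "vec_norm2 ?y = 0") (auto simp: power2_eq_square mult_le_cancel_right)
qed

section \<open>Orthogonal diagonalization of real symmetric matrices\<close>

text \<open>For an eigenvector \<open>z\<close> the scalar \<open>z\<^sup>* S z = \<lambda> z\<^sup>* z\<close> is its own conjugate.\<close>

lemma eigenvalue_sym_mat_real:
  assumes S: "sym_mat n S" and ev: "eigenvalue (map_mat complex_of_real S) l"
  shows "l \<in> \<real>"
proof -
  let ?S = "map_mat complex_of_real S"
  have Sc: "?S \<in> carrier_mat n n" "?S\<^sup>T = ?S"
    using S by (auto simp: sym_mat_def map_mat_transpose)
  obtain z where z: "z \<in> carrier_vec n" "z \<noteq> 0\<^sub>v n" "?S *\<^sub>v z = l \<cdot>\<^sub>v z"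
    using ev Sc by (auto simp: eigenvalue_def eigenvector_def)
  have zc: "conjugate z \<in> carrier_vec n" using z by simp
  have conj: "conjugate (?S *\<^sub>v z) = ?S *\<^sub>v conjugate z"
  proof (rule eq_vecI)
    fix i assume "i < dim_vec (?S *\<^sub>v conjugate z)"
    then show "conjugate (?S *\<^sub>v z) $ i = (?S *\<^sub>v conjugate z) $ i"
      using S z(1) by (auto simp: sym_mat_def scalar_prod_def)
  qed simp
  have "l * (z \<bullet>c z) = (?S *\<^sub>v z) \<bullet> conjugate z"
    using z by simp
  also have "\<dots> = z \<bullet> (?S *\<^sub>v conjugate z)"
    using transpose_vec_mult_scalar[OF Sc(1) zc z(1)] Sc by simp
  also have "\<dots> = z \<bullet> (conjugate l \<cdot>\<^sub>v conjugate z)"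
    by (simp only: conj[symmetric] z(3) conjugate_smult_vec)
  also have "\<dots> = cnj l * (z \<bullet>c z)"
    using z by simp
  finally have "l = cnj l"
    using z conjugate_square_eq_0_vec[of z n] by simp
  then show ?thesis
    by (metis Reals_cnj_iff)
qed

text \<open>An eigenvalue is guaranteed only over the complex numbers, and symmetry makes it real.
  Its complex eigenvector is discarded: the eigenvalue is a root of the real characteristic
  polynomial, which supplies a real eigenvector to be normalized.\<close>

lemma sym_mat_eigenvector:
  assumes S: "sym_mat n S" and n: "0 < n"
  obtains l v where "v \<in> carrier_vec n" "v \<bullet> v = 1" "S *\<^sub>v v = l \<cdot>\<^sub>v v"
proof -
  let ?S = "map_mat complex_of_real S"
  have Sc: "S \<in> carrier_mat n n" using S by (simp add: sym_mat_def)
  then have "spectrum ?S \<noteq> {}" using spectrum_non_empty n by simp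
  then obtain c where c: "eigenvalue ?S c" by (auto simp: spectrum_def)
  then obtain l where l: "c = complex_of_real l"
    using eigenvalue_sym_mat_real[OF S] by (auto elim: Reals_cases)
  have "poly (char_poly ?S) c = 0"
    using c Sc by (simp add: eigenvalue_root_char_poly[of _ n])
  then have "poly (char_poly S) l = 0"
    unfolding l of_real_hom.char_poly_hom[OF Sc] by simp
  then obtain w where w: "w \<in> carrier_vec n" "w \<noteq> 0\<^sub>v n" "S *\<^sub>v w = l \<cdot>\<^sub>v w"
    using Sc by (auto simp: eigenvalue_root_char_poly[symmetric] eigenvalue_def eigenvector_def)
  let ?v = "inverse (vec_norm2 w) \<cdot>\<^sub>v w"
  have pos: "0 < w \<bullet> w"
    using w scalar_prod_self_nonneg[of w] scalar_prod_self_eq_0_iff[OF w(1)] by linarith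
  show ?thesis
  proof
    show "?v \<in> carrier_vec n" using w by simp
    show "?v \<bullet> ?v = 1"
      using pos w by (simp add: vec_norm2_def field_simps)
    show "S *\<^sub>v ?v = l \<cdot>\<^sub>v ?v"
      using w mult_mat_vec[OF Sc w(1)] by (simp add: smult_smult_assoc mult.commute)
  qed
qed

text \<open>The reflection I - 2 w w^T / (w . w) in the hyperplane orthogonal to w. It provides an
  orthogonal matrix with a prescribed first column, in place of completing a unit vector to an
  orthonormal basis.\<close>

definition householder :: "real vec \<Rightarrow> real mat" where
  "householder w = mat (dim_vec w) (dim_vec w)
     (\<lambda>(i, j). (if i = j then 1 else 0) - 2 / (w \<bullet> w) * (w $ i * w $ j))"

lemma householder_mult_vec:
  assumes "w \<in> carrier_vec n" "x \<in> carrier_vec n"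
  shows "householder w *\<^sub>v x = x - (2 / (w \<bullet> w) * (w \<bullet> x)) \<cdot>\<^sub>v w"
proof (rule eq_vecI)
  fix i assume "i < dim_vec (x - (2 / (w \<bullet> w) * (w \<bullet> x)) \<cdot>\<^sub>v w)"
  then have i: "i < n" using assms by simp
  have "(householder w *\<^sub>v x) $ i
      = (\<Sum>j\<in>{0..<n}. ((if i = j then 1 else 0) - 2 / (w \<bullet> w) * (w $ i * w $ j)) * x $ j)"
    using assms i by (simp add: householder_def scalar_prod_def)
  also have "\<dots> = (\<Sum>j\<in>{0..<n}. (if i = j then x $ j else 0))
      - (\<Sum>j\<in>{0..<n}. 2 / (w \<bullet> w) * w $ i * (w $ j * x $ j))"
    unfolding sum_subtractf[symmetric]
    by (rule sum.cong) (auto simp: algebra_simps)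
  also have "\<dots> = x $ i - 2 / (w \<bullet> w) * w $ i * (w \<bullet> x)"
    using i assms by (simp add: scalar_prod_def sum_distrib_left)
  finally show "(householder w *\<^sub>v x) $ i = (x - (2 / (w \<bullet> w) * (w \<bullet> x)) \<cdot>\<^sub>v w) $ i"
    using i assms by simp
qed (use assms in \<open>simp add: householder_def\<close>)

text \<open>Unit vectors pick out the columns. This lets identities between long matrix products be
  checked by applying both sides to a vector.\<close>

lemma mat_eqI_mult_vec:
  assumes "(A :: 'a :: semiring_1 mat) \<in> carrier_mat n m" "B \<in> carrier_mat n m"
    and "\<And>x. x \<in> carrier_vec m \<Longrightarrow> A *\<^sub>v x = B *\<^sub>v x"
  shows "A = B"
proof (rule eq_matI)
  fix i j assume ij: "i < dim_row B" "j < dim_col B"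
  have "A *\<^sub>v unit_vec m j = B *\<^sub>v unit_vec m j" using assms by simp
  then have "(A *\<^sub>v unit_vec m j) $ i = (B *\<^sub>v unit_vec m j) $ i" by simp
  then show "A $$ (i, j) = B $$ (i, j)" using ij assms(1,2) by simp
qed (use assms in auto)

lemma householder:
  assumes "w \<in> carrier_vec n"
  shows "householder w \<in> carrier_mat n n" "(householder w)\<^sup>T = householder w"
    "householder w * householder w = 1\<^sub>m n"
proof -
  show H: "householder w \<in> carrier_mat n n" using assms by (simp add: householder_def)
  show "(householder w)\<^sup>T = householder w" by (auto simp: householder_def mult.commute)
  show "householder w * householder w = 1\<^sub>m n"
  proof (rule mat_eqI_mult_vec)
    fix x :: "real vec" assume x: "x \<in> carrier_vec n"
    have "householder w *\<^sub>v (householder w *\<^sub>v x) = x"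
    \<comment> \<open>For w . w = 0 the coefficient 2 / 0 is 0 and the map is the identity.
      Otherwise the first application flips the component along w, so the second one adds back
      exactly what the first subtracted.\<close>
    proof (cases "w \<bullet> w = 0")
      case True
      then show ?thesis using x assms by (auto simp: householder_mult_vec)
    next
      case False
      let ?y = "x - (2 / (w \<bullet> w) * (w \<bullet> x)) \<cdot>\<^sub>v w"
      have "w \<bullet> ?y = - (w \<bullet> x)"
        using x assms False by (simp add: scalar_prod_minus_distrib[of _ n])
      then show ?thesis
        using x assms by (auto simp: householder_mult_vec)
    qed
    then show "(householder w * householder w) *\<^sub>v x = 1\<^sub>m n *\<^sub>v x"
      using H x by simp
  qed (use H in auto)
qed

text \<open>The reflection along \<open>v - e\<^sub>0\<close>; for \<open>v = e\<^sub>0\<close> division by zero makes it the identity.\<close>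

lemma householder_unit_vec:
  assumes "v \<in> carrier_vec n" "v \<bullet> v = 1" "0 < n"
  shows "householder (v - unit_vec n 0) *\<^sub>v unit_vec n 0 = v"
proof -
  let ?e = "unit_vec n 0 :: real vec"
  let ?w = "v - ?e"
  have e: "?e \<in> carrier_vec n" by simp
  have we: "?w \<bullet> ?e = v $ 0 - 1"
    using assms by (simp add: minus_scalar_prod_distrib[of _ n])
  have wv: "?w \<bullet> v = 1 - v $ 0"
    using assms by (simp add: minus_scalar_prod_distrib[of _ n])
  have ww: "?w \<bullet> ?w = 2 - 2 * v $ 0"
    using scalar_prod_minus_distrib[of ?w n v ?e] assms we wv by simp
  show ?thesis
  proof (cases "?w \<bullet> ?w = 0")
    case True
    then have w0: "?w = 0\<^sub>v n"
      using scalar_prod_self_eq_0_iff[of ?w n] assms by simp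
    have "v $ i - ?e $ i = 0" if "i < n" for i
      using that assms w0 by (metis e carrier_vecD index_minus_vec(1) index_zero_vec(1))
    then have "v = ?e"
      using assms by (intro eq_vecI) auto
    moreover have "householder ?w *\<^sub>v ?e = ?e"
      using householder_mult_vec[of "0\<^sub>v n" n ?e] by (auto simp: w0)
    ultimately show ?thesis by simp
  next
    case False
    \<comment> \<open>With coefficient -1 the reflection sends e_0 to e_0 + (v - e_0) = v.\<close>
    then have "2 / (?w \<bullet> ?w) * (?w \<bullet> ?e) = -1"
      unfolding we ww by (simp add: field_simps)
    then show ?thesis
      using householder_mult_vec[of ?w n ?e] assms by auto
  qed
qed

section \<open>Congruence, deflation and the spectral theorem\<close>

lemma sym_mat_congruence:
  assumes "sym_mat n S" "P \<in> carrier_mat n k"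
  shows "sym_mat k (P\<^sup>T * S * P)"
proof -
  have S: "S \<in> carrier_mat n n" "S\<^sup>T = S" using assms by (auto simp: sym_mat_def)
  have "(P\<^sup>T * S * P)\<^sup>T = P\<^sup>T * (S\<^sup>T * (P\<^sup>T)\<^sup>T)"
    using S assms transpose_mult[of "P\<^sup>T * S" k n P k] transpose_mult[of "P\<^sup>T" k n S n] by simp
  also have "\<dots> = P\<^sup>T * S * P"
    using S assms by simp
  finally show ?thesis using S assms by (simp add: sym_mat_def)
qed

text \<open>The eigenvector equation determines the first column, symmetry copies its zeros into the
  first row, and the remaining block inherits symmetry.\<close>

lemma sym_mat_deflate:
  assumes T: "sym_mat (Suc n) T" and e: "T *\<^sub>v unit_vec (Suc n) 0 = l \<cdot>\<^sub>v unit_vec (Suc n) 0"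
  obtains T' where "sym_mat n T'"
    "T = four_block_mat (mat 1 1 (\<lambda>_. l)) (0\<^sub>m 1 n) (0\<^sub>m n 1) T'"
proof
  have Tc: "T \<in> carrier_mat (Suc n) (Suc n)" "T\<^sup>T = T" using T by (auto simp: sym_mat_def)
  have sym: "T $$ (i, j) = T $$ (j, i)" if "i < Suc n" "j < Suc n" for i j
    using that Tc by (metis carrier_matD index_transpose_mat(1))
  have col0: "T $$ (i, 0) = (if i = 0 then l else 0)" if "i < Suc n" for i
    using arg_cong[OF e, of "\<lambda>v. v $ i"] that Tc by simp
  let ?T' = "mat n n (\<lambda>(i, j). T $$ (Suc i, Suc j))"
  show "sym_mat n ?T'"
    using sym by (auto simp: sym_mat_def)
  show "T = four_block_mat (mat 1 1 (\<lambda>_. l)) (0\<^sub>m 1 n) (0\<^sub>m n 1) ?T'"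
  proof (rule eq_matI)
    fix i j
    assume "i < dim_row (four_block_mat (mat 1 1 (\<lambda>_. l)) (0\<^sub>m 1 n) (0\<^sub>m n 1) ?T')"
      and "j < dim_col (four_block_mat (mat 1 1 (\<lambda>_. l)) (0\<^sub>m 1 n) (0\<^sub>m n 1) ?T')"
    then have ij: "i < Suc n" "j < Suc n" by auto
    then show "T $$ (i, j) = four_block_mat (mat 1 1 (\<lambda>_. l)) (0\<^sub>m 1 n) (0\<^sub>m n 1) ?T' $$ (i, j)"
      using col0[of i] col0[of j] sym[of i j] by (cases i; cases j) auto
  qed (use Tc in auto)
qed

lemma mult_block_diag_mat:
  assumes "A1 \<in> carrier_mat m m" "A2 \<in> carrier_mat m m" "B1 \<in> carrier_mat n n" "B2 \<in> carrier_mat n n"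
  shows "four_block_mat A1 (0\<^sub>m m n) (0\<^sub>m n m) B1 * four_block_mat A2 (0\<^sub>m m n) (0\<^sub>m n m) B2
    = four_block_mat (A1 * A2) (0\<^sub>m m n) (0\<^sub>m n m) (B1 * B2)"
  using assms by (subst mult_four_block_mat) auto

text \<open>Induction on the dimension. After conjugation with a reflection the matrix is block
  diagonal with an eigenvalue in the corner; the induction hypothesis diagonalizes the other block,
  and the orthogonal factors multiply.\<close>

lemma sym_mat_diagonalization:
  "sym_mat n S \<Longrightarrow> \<exists>Q d. Q \<in> stiefel n n \<and> S = Q * mat_diag n d * Q\<^sup>T"
proof (induction n arbitrary: S)
  case 0
  then have "1\<^sub>m 0 \<in> stiefel 0 0 \<and> S = 1\<^sub>m 0 * mat_diag 0 (\<lambda>_. 0) * (1\<^sub>m 0)\<^sup>T"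
    by (auto simp: stiefel_def sym_mat_def)
  then show ?case by blast
next
  case (Suc n)
  let ?N = "Suc n"
  let ?e = "unit_vec (Suc n) 0 :: real vec"
  note assoc = assoc_mult_mat[of _ ?N ?N _ ?N _ ?N] mult_carrier_mat[of _ ?N ?N _ ?N]
  have S: "S \<in> carrier_mat ?N ?N" using Suc.prems by (simp add: sym_mat_def)
  obtain l v where v: "v \<in> carrier_vec ?N" "v \<bullet> v = 1" "S *\<^sub>v v = l \<cdot>\<^sub>v v"
    using sym_mat_eigenvector[OF Suc.prems zero_less_Suc] by blast
  \<comment> \<open>\<open>P\<close> is symmetric, its own inverse, and has the eigenvector v as
    first column, so conjugation with it turns e_0 into an eigenvector of \<open>T\<close>.\<close>
  define P where "P = householder (v - ?e)"
  have P: "P \<in> carrier_mat ?N ?N" "P\<^sup>T = P" "P * P = 1\<^sub>m ?N"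
    unfolding P_def using householder[of "v - ?e" ?N] v by auto
  have Pe: "P *\<^sub>v ?e = v"
    unfolding P_def using householder_unit_vec v by blast
  have Pv: "P *\<^sub>v v = ?e"
    using P assoc_mult_mat_vec[of P ?N ?N P ?N ?e] by (simp add: Pe)
  define T where "T = P\<^sup>T * S * P"
  have T: "sym_mat ?N T"
    unfolding T_def using Suc.prems P by (intro sym_mat_congruence)
  have "T *\<^sub>v ?e = P *\<^sub>v (S *\<^sub>v (P *\<^sub>v ?e))"
    using S P by (simp add: T_def assoc_mult_mat_vec[of _ ?N ?N _ ?N] assoc)
  also have "\<dots> = l \<cdot>\<^sub>v ?e"
    using v P by (simp add: Pe Pv mult_mat_vec)
  finally obtain T' where T': "sym_mat n T'"
    and T_eq: "T = four_block_mat (mat 1 1 (\<lambda>_. l)) (0\<^sub>m 1 n) (0\<^sub>m n 1) T'"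
    using sym_mat_deflate[OF T] by blast
  obtain Q' d' where Q': "Q' \<in> carrier_mat n n" "Q'\<^sup>T * Q' = 1\<^sub>m n" "T' = Q' * mat_diag n d' * Q'\<^sup>T"
    using Suc.IH[OF T'] by (auto simp: stiefel_def)
  define W where "W = four_block_mat (1\<^sub>m 1) (0\<^sub>m 1 n) (0\<^sub>m n 1) Q'"
  define d where "d = case_nat l d'"
  have D: "mat_diag ?N d = four_block_mat (mat 1 1 (\<lambda>_. l)) (0\<^sub>m 1 n) (0\<^sub>m n 1) (mat_diag n d')"
    by (rule eq_matI) (auto simp: mat_diag_def d_def split: nat.split)
  have W: "W \<in> carrier_mat ?N ?N" using Q' by (auto simp: W_def)
  have Wt: "W\<^sup>T = four_block_mat (1\<^sub>m 1) (0\<^sub>m 1 n) (0\<^sub>m n 1) (Q'\<^sup>T)"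
    unfolding W_def using Q' by (subst transpose_four_block_mat) auto
  have WW: "W\<^sup>T * W = 1\<^sub>m ?N"
    unfolding Wt unfolding W_def using Q' mult_block_diag_mat[of "1\<^sub>m 1" 1 "1\<^sub>m 1" "Q'\<^sup>T" n Q']
    by (simp add: four_block_one_mat)
  have "W * mat_diag ?N d * W\<^sup>T = T"
    unfolding T_eq Wt D unfolding W_def using Q'
    by (simp add: mult_block_diag_mat[of _ "Suc 0" _ _ n] mult_carrier_mat[of _ n n _ n] del: assoc_mult_mat)
  then have "S = P * (W * mat_diag ?N d * W\<^sup>T) * P"
    using P S by (simp add: T_def assoc flip: assoc_mult_mat[of P ?N ?N P ?N S ?N])
  also have "\<dots> = (P * W) * mat_diag ?N d * (P * W)\<^sup>T"
    using P W by (simp add: assoc transpose_mult[of P ?N ?N W ?N])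
  finally have "S = (P * W) * mat_diag ?N d * (P * W)\<^sup>T" .
  moreover have "(P * W)\<^sup>T * (P * W) = 1\<^sub>m ?N"
    using P W WW by (simp add: transpose_mult[of P ?N ?N W ?N] assoc
        flip: assoc_mult_mat[of P ?N ?N P ?N W ?N])
  moreover have "P * W \<in> carrier_mat ?N ?N" using P W by simp
  ultimately show ?case unfolding stiefel_def by (intro exI conjI CollectI)
qed

section \<open>The principal square root\<close>

text \<open>In the coordinates y = Q^T x, obtained by moving Q across the scalar product, the form
  is diagonal.\<close>

lemma quadratic_form_diagonalization:
  fixes Q :: "'a :: comm_ring_1 mat" and x :: "'a vec"
  assumes "Q \<in> carrier_mat n n" "x \<in> carrier_vec n"
  shows "x \<bullet> ((Q * mat_diag n d * Q\<^sup>T) *\<^sub>v x) = (\<Sum>i<n. d i * ((Q\<^sup>T *\<^sub>v x) $ i)\<^sup>2)"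
proof -
  let ?y = "Q\<^sup>T *\<^sub>v x"
  have y: "?y \<in> carrier_vec n" using assms by simp
  have "(Q * mat_diag n d * Q\<^sup>T) *\<^sub>v x = Q *\<^sub>v (mat_diag n d *\<^sub>v ?y)"
    using assms by (simp add: assoc_mult_mat_vec[of _ n n _ n] assoc_mult_mat[of _ n n _ n _ n]
        mult_carrier_mat[of _ n n _ n])
  moreover have "x \<bullet> (Q *\<^sub>v (mat_diag n d *\<^sub>v ?y)) = ?y \<bullet> (mat_diag n d *\<^sub>v ?y)"
    using assms transpose_vec_mult_scalar[of Q n n "mat_diag n d *\<^sub>v ?y" x] y
    by (simp add: mult_mat_vec_carrier[of _ n n])
  moreover have "mat_diag n d *\<^sub>v ?y = vec n (\<lambda>i. d i * ?y $ i)"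
  proof (rule eq_vecI)
    fix i assume "i < dim_vec (vec n (\<lambda>i. d i * ?y $ i))"
    then have i: "i < n" by simp
    have "(mat_diag n d *\<^sub>v y) $ i = d i * y $ i" if "y \<in> carrier_vec n" for y
    proof -
      have "(mat_diag n d *\<^sub>v y) $ i = (\<Sum>j\<in>{0..<n}. (if i = j then d j else 0) * y $ j)"
        using that i by (simp add: mat_diag_def scalar_prod_def)
      also have "\<dots> = (\<Sum>j\<in>{0..<n}. if i = j then d j * y $ j else 0)"
        by (rule sum.cong) auto
      finally show ?thesis using i by simp
    qed
    from this[OF y] show "(mat_diag n d *\<^sub>v ?y) $ i = vec n (\<lambda>i. d i * ?y $ i) $ i"
      using i by (simp del: index_mult_mat_vec)
  qed (simp add: mat_diag_def)
  ultimately show ?thesis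
    using assms by (simp add: scalar_prod_def[of ?y] power2_eq_square lessThan_atLeast0
        mult.left_commute del: index_mult_mat_vec)
qed

lemma stiefel_square:
  assumes "Q \<in> stiefel n n"
  shows "Q \<in> carrier_mat n n" "Q\<^sup>T * Q = 1\<^sub>m n" "Q * Q\<^sup>T = 1\<^sub>m n"
proof -
  show "Q \<in> carrier_mat n n" "Q\<^sup>T * Q = 1\<^sub>m n" using assms by (auto simp: stiefel_def)
  then show "Q * Q\<^sup>T = 1\<^sub>m n" by (auto intro: mat_mult_left_right_inverse[of "Q\<^sup>T" n Q])
qed

text \<open>These are the test vectors of the next proofs: the i-th column of Q has coordinates e_i
  in the basis Q, so it isolates the i-th diagonal entry. It is nonzero because Q^T maps it to
  e_i.\<close>

lemma stiefel_unit_vec: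
  assumes "Q \<in> stiefel n n" "i < n"
  shows "Q *\<^sub>v unit_vec n i \<in> carrier_vec n" "Q *\<^sub>v unit_vec n i \<noteq> 0\<^sub>v n"
    "Q\<^sup>T *\<^sub>v (Q *\<^sub>v unit_vec n i) = unit_vec n i"
proof -
  note Q = stiefel_square[OF assms(1)]
  show "Q *\<^sub>v unit_vec n i \<in> carrier_vec n"
    using Q by (intro mult_mat_vec_carrier) auto
  show *: "Q\<^sup>T *\<^sub>v (Q *\<^sub>v unit_vec n i) = unit_vec n i"
    using Q assoc_mult_mat_vec[of "Q\<^sup>T" n n Q n "unit_vec n i"] by simp
  show "Q *\<^sub>v unit_vec n i \<noteq> 0\<^sub>v n"
  proof
    assume "Q *\<^sub>v unit_vec n i = 0\<^sub>v n"
    then have "unit_vec n i = Q\<^sup>T *\<^sub>v 0\<^sub>v n" using * by simp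
    also have "\<dots> = 0\<^sub>v n" using Q by (intro eq_vecI) auto
    finally have "unit_vec n i $ i = (0\<^sub>v n :: real vec) $ i" by simp
    then show False using assms by simp
  qed
qed

text \<open>Evaluating the form of M at the columns of Q shows that all diagonal entries are
  positive; replacing them by their square roots gives R.\<close>

lemma pos_def_mat_sqrt_exists:
  assumes M: "pos_def_mat n M"
  obtains R where "pos_def_mat n R" "R * R = M"
proof -
  have "sym_mat n M" using M by (simp add: pos_def_mat_def)
  then obtain Q d where Q: "Q \<in> stiefel n n" and Md: "M = Q * mat_diag n d * Q\<^sup>T"
    using sym_mat_diagonalization by blast
  note Qn = stiefel_square[OF Q]
  note assoc = assoc_mult_mat[of _ n n _ n _ n] mult_carrier_mat[of _ n n _ n]
  have d: "0 < d i" if "i < n" for i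
  proof -
    let ?x = "Q *\<^sub>v unit_vec n i"
    have "0 < ?x \<bullet> (M *\<^sub>v ?x)"
      using M stiefel_unit_vec[OF Q that] by (simp add: pos_def_mat_def)
    also have "\<dots> = (\<Sum>j<n. d j * (unit_vec n i $ j)\<^sup>2)"
      unfolding Md quadratic_form_diagonalization[OF Qn(1) stiefel_unit_vec(1)[OF Q that]]
      by (simp only: stiefel_unit_vec(3)[OF Q that])
    also have "\<dots> = (\<Sum>j<n. if j = i then d j else 0)"
      using that by (intro sum.cong) (auto simp: unit_vec_def)
    also have "\<dots> = d i" using that by simp
    finally show ?thesis .
  qed
  define s where "s i = sqrt (d i)" for i
  define R where "R = Q * mat_diag n s * Q\<^sup>T"
  have "sym_mat n (mat_diag n s)"
    by (auto simp: sym_mat_def mat_diag_def)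
  then have Rs: "sym_mat n R"
    using sym_mat_congruence[of n "mat_diag n s" "Q\<^sup>T" n] Qn by (simp add: R_def)
  have "0 < x \<bullet> (R *\<^sub>v x)" if x: "x \<in> carrier_vec n" "x \<noteq> 0\<^sub>v n" for x
  proof -
    let ?y = "Q\<^sup>T *\<^sub>v x"
    have "Q *\<^sub>v ?y = x"
      using Qn x assoc_mult_mat_vec[of Q n n "Q\<^sup>T" n x] by simp
    moreover have "Q *\<^sub>v 0\<^sub>v n = 0\<^sub>v n"
      using Qn(1) by (intro eq_vecI) auto
    ultimately have "?y \<noteq> 0\<^sub>v n"
      using x by metis
    \<comment> \<open>Since Q y = x is nonzero, y has a nonzero coordinate; its term is positive and
      the other terms of the form are nonnegative.\<close>
    then obtain i where i: "i < n" "?y $ i \<noteq> 0"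
      using Qn(1) by (metis carrier_matD(2) dim_mult_mat_vec eq_vecI index_transpose_mat(2)
          index_zero_vec(1) index_zero_vec(2))
    then have "0 < s i * (?y $ i)\<^sup>2" using d[OF i(1)] by (simp add: s_def)
    also have "\<dots> \<le> (\<Sum>i<n. s i * (?y $ i)\<^sup>2)"
      using i d by (intro member_le_sum) (auto simp: s_def less_imp_le)
    finally show ?thesis
      unfolding R_def quadratic_form_diagonalization[OF Qn(1) x(1)] .
  qed
  then have "pos_def_mat n R" using Rs by (simp add: pos_def_mat_def)
  moreover have "R * R = M"
  proof -
    have "R * R = Q * mat_diag n s * ((Q\<^sup>T * Q) * mat_diag n s * Q\<^sup>T)"
      using Qn(1) by (simp add: R_def assoc)
    also have "\<dots> = Q * (mat_diag n s * mat_diag n s) * Q\<^sup>T"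
      using Qn(1) unfolding Qn(2) by (simp add: assoc left_mult_one_mat[of _ n n] del: mat_diag_diag)
    also have "mat_diag n s * mat_diag n s = mat_diag n d"
      using d unfolding mat_diag_diag by (intro eq_matI) (auto simp: mat_diag_def s_def less_imp_le)
    finally show ?thesis by (simp add: Md)
  qed
  ultimately show thesis by (rule that)
qed

text \<open>Let q be an eigenvector of the symmetric matrix R - R' with eigenvalue d. Then 0 = |R
  q|^2 - |R' q|^2 = (R q - R' q) . (R q + R' q) = d (q . R q + q . R' q), where the first equality
  is R R = R' R'. The last factor is positive, so d = 0; thus all eigenvalues of R - R'
  vanish.\<close>

lemma mat_sqrt_unique:
  assumes R: "pos_def_mat n R" and R': "pos_semidef_mat n R'" and eq: "R * R = R' * R'"
  shows "R' = R"
proof -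
  have Rc: "R \<in> carrier_mat n n" "R\<^sup>T = R" "R' \<in> carrier_mat n n" "R'\<^sup>T = R'"
    using R R' by (auto simp: pos_def_mat_def pos_semidef_mat_def sym_mat_def)
  have "sym_mat n (R - R')"
    using Rc by (auto simp: sym_mat_def transpose_minus[of _ n n] minus_carrier_mat)
  then obtain Q d where Q: "Q \<in> stiefel n n" and Td: "R - R' = Q * mat_diag n d * Q\<^sup>T"
    using sym_mat_diagonalization by blast
  note Qn = stiefel_square[OF Q]
  have "d i = 0" if i: "i < n" for i
  proof -
    let ?q = "Q *\<^sub>v unit_vec n i"
    let ?a = "R *\<^sub>v ?q"
    let ?b = "R' *\<^sub>v ?q"
    note q = stiefel_unit_vec[OF Q i]
    have ab: "?a \<in> carrier_vec n" "?b \<in> carrier_vec n" using Rc q by (auto intro: mult_mat_vec_carrier)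
    have "mat_diag n d *\<^sub>v unit_vec n i = d i \<cdot>\<^sub>v unit_vec n i"
      using i by (intro eq_vecI) (auto simp: mat_diag_def)
    then have "(R - R') *\<^sub>v ?q = d i \<cdot>\<^sub>v ?q"
      unfolding Td using Qn q
      by (simp add: assoc_mult_mat_vec[of _ n n _ n] assoc_mult_mat[of _ n n _ n _ n]
          mult_carrier_mat[of _ n n _ n] mult_mat_vec)
    then have diff: "?a - ?b = d i \<cdot>\<^sub>v ?q"
      using Rc q by (simp add: minus_mult_distrib_mat_vec)
    have "?a \<bullet> ?a = ?q \<bullet> ((R * R) *\<^sub>v ?q)"
      using transpose_vec_mult_scalar[of R n n ?a ?q] Rc q ab
      by (simp add: assoc_mult_mat_vec[of _ n n _ n])
    also have "\<dots> = ?b \<bullet> ?b"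
      unfolding eq using transpose_vec_mult_scalar[of R' n n ?b ?q] Rc q ab
      by (simp add: assoc_mult_mat_vec[of _ n n _ n])
    finally have "(?a - ?b) \<bullet> (?a + ?b) = 0"
      using ab comm_scalar_prod[of ?a n ?b]
      by (simp add: minus_scalar_prod_distrib[of _ n] scalar_prod_add_distrib[of _ n])
    then have "d i * (?q \<bullet> ?a + ?q \<bullet> ?b) = 0"
      unfolding diff using ab q by (simp add: scalar_prod_add_distrib[of _ n] distrib_left)
    moreover have "0 < ?q \<bullet> ?a" "0 \<le> ?q \<bullet> ?b"
      using R R' q by (auto simp: pos_def_mat_def pos_semidef_mat_def)
    ultimately show ?thesis by (auto dest: add_pos_nonneg)
  qed
  then have "mat_diag n d = 0\<^sub>m n n"
    by (intro eq_matI) (auto simp: mat_diag_def)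
  then have "R - R' = 0\<^sub>m n n" using Td Qn by simp
  then have "(R - R') $$ (i, j) = 0" if "i < n" "j < n" for i j using that by simp
  then show ?thesis
    using Rc by (intro eq_matI) auto
qed

text \<open>The description in \<open>mat_sqrt\<close> ranges over positive semidefinite roots,
  which is why the uniqueness lemma compares a positive definite root with a merely semidefinite
  one.\<close>

lemma mat_sqrt_pos_def:
  assumes M: "pos_def_mat n M"
  shows "pos_def_mat n (mat_sqrt M)" "mat_sqrt M * mat_sqrt M = M"
proof -
  have "dim_row M = n" using M by (auto simp: pos_def_mat_def sym_mat_def)
  obtain R where R: "pos_def_mat n R" "R * R = M"
    using pos_def_mat_sqrt_exists[OF M] .
  have psd: "pos_semidef_mat n R"
    unfolding pos_semidef_mat_def
  proof (intro conjI ballI)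
    fix x :: "real vec" assume "x \<in> carrier_vec n"
    then show "0 \<le> x \<bullet> (R *\<^sub>v x)"
      using R(1) by (cases "x = 0\<^sub>v n") (auto simp: pos_def_mat_def sym_mat_def less_imp_le)
  qed (use R in \<open>simp add: pos_def_mat_def\<close>)
  have "mat_sqrt M = R"
    unfolding mat_sqrt_def \<open>dim_row M = n\<close>
  proof (rule the_equality)
    show "pos_semidef_mat n R \<and> R * R = M" using R psd by blast
    show "R' = R" if "pos_semidef_mat n R' \<and> R' * R' = M" for R'
      using mat_sqrt_unique[OF R(1), of R'] that R(2) by metis
  qed
  with R show "pos_def_mat n (mat_sqrt M)" "mat_sqrt M * mat_sqrt M = M" by auto
qed

text \<open>A nonzero kernel vector v would give v . R v = 0, against definiteness. So the
  determinant is nonzero and \<open>mat_inverse\<close> does not return \<open>None\<close>.\<close>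

lemma pos_def_mat_inverse:
  assumes R: "pos_def_mat n R"
  shows "the (mat_inverse R) \<in> carrier_mat n n"
    "R * the (mat_inverse R) = 1\<^sub>m n" "the (mat_inverse R) * R = 1\<^sub>m n"
proof -
  have Rc: "R \<in> carrier_mat n n" using R by (simp add: pos_def_mat_def sym_mat_def)
  have "det R \<noteq> 0"
  proof
    assume "det R = 0"
    then obtain v where "v \<in> carrier_vec n" "v \<noteq> 0\<^sub>v n" "R *\<^sub>v v = 0\<^sub>v n"
      using det_0_iff_vec_prod_zero[OF Rc] by auto
    then show False using R by (force simp: pos_def_mat_def)
  qed
  then have "mat_inverse R \<noteq> None"
    using det_non_zero_imp_unit[OF Rc, of "()"] mat_inverse(1)[OF Rc, of "()"] by blast
  then obtain X where "mat_inverse R = Some X" by auto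
  with mat_inverse(2)[OF Rc this]
  show "the (mat_inverse R) \<in> carrier_mat n n"
    "R * the (mat_inverse R) = 1\<^sub>m n" "the (mat_inverse R) * R = 1\<^sub>m n" by auto
qed

lemma mat_inv_sqrt_pos_def:
  assumes M: "pos_def_mat n M"
  shows "mat_inv_sqrt M \<in> carrier_mat n n" "(mat_inv_sqrt M)\<^sup>T = mat_inv_sqrt M"
    "mat_sqrt M * mat_inv_sqrt M = 1\<^sub>m n" "mat_inv_sqrt M * mat_sqrt M = 1\<^sub>m n"
proof -
  let ?R = "mat_sqrt M" and ?X = "mat_inv_sqrt M"
  have R: "?R \<in> carrier_mat n n" "?R\<^sup>T = ?R"
    using mat_sqrt_pos_def(1)[OF M] by (auto simp: pos_def_mat_def sym_mat_def)
  show X: "?X \<in> carrier_mat n n" and RX: "?R * ?X = 1\<^sub>m n" and "?X * ?R = 1\<^sub>m n"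
    unfolding mat_inv_sqrt_def using pos_def_mat_inverse[OF mat_sqrt_pos_def(1)[OF M]] by auto
  \<comment> \<open>Transposing R X = I makes X^T a left inverse of R, and a left inverse equals the
    right inverse X.\<close>
  have "?X\<^sup>T * ?R = 1\<^sub>m n"
    using transpose_mult[OF R(1) X] by (simp add: RX R(2))
  then have "?X = (?X\<^sup>T * ?R) * ?X" using X by simp
  also have "\<dots> = ?X\<^sup>T"
    using X R by (simp add: RX assoc_mult_mat[of _ n n _ n _ n])
  finally show "?X\<^sup>T = ?X" by simp
qed

text \<open>For y = M^{-1/2} z one has M^{1/2} y = z, hence c |y|^2 <= y . M y = |M^{1/2} y|^2 =
  |z|^2.\<close>

lemma vec_norm2_mat_inv_sqrt_le:
  assumes M: "pos_def_mat n M" and c: "0 < c"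
    and lower: "\<And>y. y \<in> carrier_vec n \<Longrightarrow> c * (vec_norm2 y)\<^sup>2 \<le> y \<bullet> (M *\<^sub>v y)"
    and z: "z \<in> carrier_vec n"
  shows "vec_norm2 (mat_inv_sqrt M *\<^sub>v z) \<le> vec_norm2 z / sqrt c"
proof -
  let ?R = "mat_sqrt M" and ?X = "mat_inv_sqrt M"
  let ?y = "?X *\<^sub>v z"
  have R: "?R \<in> carrier_mat n n" "?R\<^sup>T = ?R"
    using mat_sqrt_pos_def(1)[OF M] by (auto simp: pos_def_mat_def sym_mat_def)
  note X = mat_inv_sqrt_pos_def[OF M]
  have y: "?y \<in> carrier_vec n" using X z by (auto intro: mult_mat_vec_carrier)
  have Ry: "?R *\<^sub>v ?y = z"
    using assoc_mult_mat_vec[OF R(1) X(1) z] X(3) z by simp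
  have "c * (vec_norm2 ?y)\<^sup>2 \<le> ?y \<bullet> ((?R * ?R) *\<^sub>v ?y)"
    using lower[OF y] by (simp add: mat_sqrt_pos_def(2)[OF M])
  also have "\<dots> = (?R *\<^sub>v ?y) \<bullet> (?R *\<^sub>v ?y)"
    using transpose_vec_mult_scalar[OF R(1), of "?R *\<^sub>v ?y" ?y] R y z
      comm_scalar_prod[of ?y n "?R *\<^sub>v (?R *\<^sub>v ?y)"]
    by (simp add: assoc_mult_mat_vec[OF R(1) R(1) y] mult_mat_vec_carrier[OF R(1)] Ry)
  also have "\<dots> = (vec_norm2 z)\<^sup>2"
    by (simp add: Ry vec_norm2_sq)
  finally have "(sqrt c * vec_norm2 ?y)\<^sup>2 \<le> (vec_norm2 z)\<^sup>2"
    using c by (simp add: power_mult_distrib)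
  then have "sqrt c * vec_norm2 ?y \<le> vec_norm2 z"
    by (rule power2_le_imp_le) simp
  then show ?thesis using c by (simp add: field_simps)
qed

text \<open>This is the orthonormal factor in the polar decomposition of E: with R the root of E^T E
  and X its inverse, the Gram matrix is X (R R) X = I.\<close>

lemma mat_inv_sqrt_stiefel:
  assumes E: "E \<in> carrier_mat j k" and M: "pos_def_mat k (E\<^sup>T * E)"
  shows "E * mat_inv_sqrt (E\<^sup>T * E) \<in> stiefel j k"
proof -
  let ?R = "mat_sqrt (E\<^sup>T * E)" and ?X = "mat_inv_sqrt (E\<^sup>T * E)"
  have R: "?R \<in> carrier_mat k k"
    using mat_sqrt_pos_def(1)[OF M] by (auto simp: pos_def_mat_def sym_mat_def)
  note X = mat_inv_sqrt_pos_def[OF M]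
  have Et: "E\<^sup>T \<in> carrier_mat k j" using E by simp
  have "(E * ?X)\<^sup>T * (E * ?X) = ?X * E\<^sup>T * (E * ?X)"
    using transpose_mult[OF E X(1)] X(2) by simp
  also have "\<dots> = ?X * ((E\<^sup>T * E) * ?X)"
    using assoc_mult_mat[OF X(1) Et mult_carrier_mat[OF E X(1)]] assoc_mult_mat[OF Et E X(1)] by simp
  also have "\<dots> = ?X * ((?R * ?R) * ?X)"
    by (simp only: mat_sqrt_pos_def(2)[OF M])
  also have "\<dots> = (?X * ?R) * (?R * ?X)"
    using assoc_mult_mat[OF X(1) R mult_carrier_mat[OF R X(1)]] assoc_mult_mat[OF R R X(1)] by simp
  also have "\<dots> = 1\<^sub>m k"
    using X by simp
  finally show ?thesis
    using mult_carrier_mat[OF E X(1)] by (simp add: stiefel_def)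
qed

section \<open>Orthogonal complements\<close>

text \<open>Turns the hypothesis on column spaces into a matrix identity: each entry is the scalar
  product of a column of U and a column of W, and columns lie in the column space.\<close>

lemma orthogonal_complement_transpose_mult:
  fixes U W :: "real mat"
  assumes U: "U \<in> carrier_mat n j" and W: "W \<in> carrier_mat n m"
    and eq: "vec_space.col_space n W = vec_module.orthogonal_complement n (vec_space.col_space n U)"
  shows "U\<^sup>T * W = 0\<^sub>m j m"
proof -
  interpret vec_space "TYPE(real)" n .
  have col: "col M i \<in> col_space M" if "M \<in> carrier_mat n c" "i < c" for M :: "real mat" and i c
  proof -
    have "M *\<^sub>v unit_vec c i = col M i" using that by (intro eq_vecI) auto
    then show ?thesis unfolding col_space_eq[OF that(1)] using that by force
  qed
  show ?thesis
  proof (rule eq_matI)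
    fix a b assume "a < dim_row (0\<^sub>m j m :: real mat)" "b < dim_col (0\<^sub>m j m :: real mat)"
    then have ab: "a < j" "b < m" by auto
    have "col W b \<bullet> col U a = 0"
      using col[OF W ab(2)] col[OF U ab(1)] unfolding eq orthogonal_complement_def by blast
    then have "col U a \<bullet> col W b = 0"
      using comm_scalar_prod[of "col U a" n "col W b"] U W ab by simp
    then show "(U\<^sup>T * W) $$ (a, b) = 0\<^sub>m j m $$ (a, b)"
      using U W ab by simp
  qed (use U W in auto)
qed

text \<open>The block matrix \<open>[U, W]\<close> is square with orthonormal columns, hence its rows are
  orthonormal as well; it is written with empty lower blocks.\<close>

lemma stiefel_complement_resolution:
  assumes U: "U \<in> stiefel n j" and W: "W \<in> stiefel n (n - j)" and j: "j \<le> n"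
    and orth: "U\<^sup>T * W = 0\<^sub>m j (n - j)"
  shows "U * U\<^sup>T + W * W\<^sup>T = 1\<^sub>m n"
proof -
  have Uc: "U \<in> carrier_mat n j" "U\<^sup>T * U = 1\<^sub>m j"
    and Wc: "W \<in> carrier_mat n (n - j)" "W\<^sup>T * W = 1\<^sub>m (n - j)"
    using U W by (auto simp: stiefel_def)
  have orth': "W\<^sup>T * U = 0\<^sub>m (n - j) j"
    using arg_cong[OF orth, of transpose_mat] transpose_mult[of "U\<^sup>T" j n W "n - j"] Uc Wc by simp
  define Q where "Q = four_block_mat U W (0\<^sub>m 0 j) (0\<^sub>m 0 (n - j))"
  have Q: "Q \<in> carrier_mat n n"
    using four_block_carrier_mat[OF Uc(1), of "0\<^sub>m 0 (n - j)" 0 "n - j" W "0\<^sub>m 0 j"] j by (simp add: Q_def)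
  have Qt: "Q\<^sup>T = four_block_mat U\<^sup>T (0\<^sub>m j 0) W\<^sup>T (0\<^sub>m (n - j) 0)"
    unfolding Q_def using Uc Wc by (subst transpose_four_block_mat) auto
  have "Q\<^sup>T * Q = four_block_mat (1\<^sub>m j) (0\<^sub>m j (n - j)) (0\<^sub>m (n - j) j) (1\<^sub>m (n - j))"
    unfolding Qt unfolding Q_def using Uc Wc orth orth'
    by (subst mult_four_block_mat[of _ j n _ 0 _ "n - j" _ _ j _ "n - j"]) auto
  also have "\<dots> = 1\<^sub>m n"
    using four_block_one_mat[of j "n - j"] j by simp
  finally have "Q * Q\<^sup>T = 1\<^sub>m n"
    using Q by (auto intro: mat_mult_left_right_inverse[of "Q\<^sup>T" n Q])
  moreover have "Q * Q\<^sup>T = four_block_mat (U * U\<^sup>T + W * W\<^sup>T) (0\<^sub>m n 0) (0\<^sub>m 0 n) (0\<^sub>m 0 0)"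
    unfolding Qt unfolding Q_def using Uc Wc
    by (subst mult_four_block_mat[of _ n j _ "n - j" _ 0 _ _ n _ 0]) auto
  ultimately have block: "four_block_mat (U * U\<^sup>T + W * W\<^sup>T) (0\<^sub>m n 0) (0\<^sub>m 0 n) (0\<^sub>m 0 0) = 1\<^sub>m n" by simp
  show ?thesis
  proof (rule eq_matI)
    fix a b assume "a < dim_row (1\<^sub>m n :: real mat)" "b < dim_col (1\<^sub>m n :: real mat)"
    then show "(U * U\<^sup>T + W * W\<^sup>T) $$ (a, b) = 1\<^sub>m n $$ (a, b)"
      using arg_cong[OF block, of "\<lambda>M. M $$ (a, b)"] Uc Wc by simp
  qed (use Uc Wc in auto)
qed

lemma vec_norm2_resolution:
  assumes U: "U \<in> carrier_mat n j" and W: "W \<in> carrier_mat n m"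
    and res: "U * U\<^sup>T + W * W\<^sup>T = 1\<^sub>m n" and x: "x \<in> carrier_vec n"
  shows "(vec_norm2 x)\<^sup>2 = (vec_norm2 (U\<^sup>T *\<^sub>v x))\<^sup>2 + (vec_norm2 (W\<^sup>T *\<^sub>v x))\<^sup>2"
proof -
  let ?u = "U\<^sup>T *\<^sub>v x" and ?w = "W\<^sup>T *\<^sub>v x"
  have u: "?u \<in> carrier_vec j" and w: "?w \<in> carrier_vec m" using U W x by auto
  have "x = (U * U\<^sup>T + W * W\<^sup>T) *\<^sub>v x" using x by (simp add: res)
  also have "\<dots> = U *\<^sub>v ?u + W *\<^sub>v ?w"
    using U W x by (simp add: add_mult_distrib_mat_vec[of _ n n] assoc_mult_mat_vec[of _ n _ _ n])
  finally have "x \<bullet> x = x \<bullet> (U *\<^sub>v ?u + W *\<^sub>v ?w)" by simp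
  also have "\<dots> = x \<bullet> (U *\<^sub>v ?u) + x \<bullet> (W *\<^sub>v ?w)"
    using x u w U W by (intro scalar_prod_add_distrib) auto
  also have "\<dots> = ?u \<bullet> ?u + ?w \<bullet> ?w"
    by (simp add: transpose_vec_mult_scalar[OF U u x] transpose_vec_mult_scalar[OF W w x])
  finally show ?thesis by (simp add: vec_norm2_sq)
qed

section \<open>The perturbed eigenblock\<close>

lemma smult_mat_mult_vec:
  fixes A :: "'a :: comm_semiring_0 mat"
  assumes "A \<in> carrier_mat nr nc" "v \<in> carrier_vec nc"
  shows "(c \<cdot>\<^sub>m A) *\<^sub>v v = c \<cdot>\<^sub>v (A *\<^sub>v v)"
proof (rule eq_vecI)
  fix i assume "i < dim_vec (c \<cdot>\<^sub>v (A *\<^sub>v v))"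
  then show "((c \<cdot>\<^sub>m A) *\<^sub>v v) $ i = (c \<cdot>\<^sub>v (A *\<^sub>v v)) $ i"
    using assms smult_scalar_prod_distrib[of "row A i" nc v c] by simp
qed simp

text \<open>Over the complex numbers the multiset contains all n roots of the characteristic
  polynomial, so no eigenvalue is lost in the comparison. The polynomial itself is the image of the
  real one, which similarity preserves.\<close>

lemma eigvals_similar:
  fixes M N :: "real mat"
  assumes "M \<in> carrier_mat n n" "N \<in> carrier_mat n n" "similar_mat M N"
  shows "eigvals (map_mat complex_of_real M) = eigvals (map_mat complex_of_real N)"
  unfolding eigvals_def
  by (simp add: of_real_hom.char_poly_hom[OF assms(1)] of_real_hom.char_poly_hom[OF assms(2)]
      char_poly_similar[OF assms(3)])

text \<open>A maximum over a subset of the feasible matrices; it fixes the sign of rho* - rho in the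
  norm bound.\<close>

lemma projected_trace_ratio_max_le:
  assumes "trace_ratio_solution p k A B V rs" "projected_trace_ratio_max p k A B U r"
  shows "r \<le> rs"
  using assms
  by (auto simp: trace_ratio_solution_def projected_trace_ratio_max_def is_arg_max_linorder)

theorem proposition5:
  fixes A B Vs \<Lambda>s U Uperp E F H K Ehat G R Ri :: "real mat"
    and p k j :: nat and \<rho>s \<rho> \<theta> :: real
  assumes A: "sym_mat p A"
    and B: "pos_def_mat p B"
    and k: "1 \<le> k" "k < p"
    and sol: "trace_ratio_solution p k A B Vs \<rho>s"
    and \<Lambda>s: "\<Lambda>s \<in> carrier_mat k k" "(A - \<rho>s \<cdot>\<^sub>m B) * Vs = Vs * \<Lambda>s"
    and gap: "eig k (A - \<rho>s \<cdot>\<^sub>m B) > eig (k + 1) (A - \<rho>s \<cdot>\<^sub>m B)"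
    and j: "k \<le> j" "j \<le> p"
    and U: "U \<in> stiefel p j"
    and \<rho>: "projected_trace_ratio_max p k A B U \<rho>"
    and Uperp: "Uperp \<in> stiefel p (p - j)"
      "vec_space.col_space p Uperp = vec_module.orthogonal_complement p (vec_space.col_space p U)"
    and E: "E = U\<^sup>T * Vs"
    and F: "F = Uperp\<^sup>T * Vs"
    and H: "H = U\<^sup>T * A * U"
    and K: "K = U\<^sup>T * B * U"
    and \<theta>: "sin \<theta> = spectral_norm (Uperp\<^sup>T * Vs)" "sin \<theta> < 1"
    and R: "R = mat_sqrt (E\<^sup>T * E)"
    and Ri: "Ri = mat_inv_sqrt (E\<^sup>T * E)"
    and Ehat: "Ehat = E * Ri"
    and G: "G = ((\<rho> - \<rho>s) \<cdot>\<^sub>m (K * Ehat) + U\<^sup>T * (A - \<rho>s \<cdot>\<^sub>m B) * Uperp * F * Ri) * Ehat\<^sup>T"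
  shows "Vs = U * E + Uperp * F
    \<and> Ehat \<in> stiefel j k
    \<and> spectral_norm G \<le> (\<rho>s - \<rho>) * spectral_norm B
          + sin \<theta> / sqrt (1 - (sin \<theta>)\<^sup>2) * spectral_norm (A - \<rho>s \<cdot>\<^sub>m B)
    \<and> (H - \<rho> \<cdot>\<^sub>m K + G) * Ehat = Ehat * (R * \<Lambda>s * Ri)
    \<and> eigvals (map_mat complex_of_real (R * \<Lambda>s * Ri)) = eigvals (map_mat complex_of_real \<Lambda>s)"
proof -
  define C where "C = A - \<rho>s \<cdot>\<^sub>m B"
  define s where "s = sin \<theta>"
  have Ac: "A \<in> carrier_mat p p" and Bc: "B \<in> carrier_mat p p"
    using A B by (auto simp: sym_mat_def pos_def_mat_def)
  then have Cc: "C \<in> carrier_mat p p" by (simp add: C_def minus_carrier_mat)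
  have Vs: "Vs \<in> stiefel p k"
    using sol by (auto simp: trace_ratio_solution_def is_arg_max_def)
  then have Vc: "Vs \<in> carrier_mat p k" by (simp add: stiefel_def)
  have Uc: "U \<in> carrier_mat p j" and Wc: "Uperp \<in> carrier_mat p (p - j)"
    using U Uperp by (auto simp: stiefel_def)
  have Utc: "U\<^sup>T \<in> carrier_mat j p" and Wtc: "Uperp\<^sup>T \<in> carrier_mat (p - j) p"
    using Uc Wc by auto
  have Ec: "E \<in> carrier_mat j k" and Fc: "F \<in> carrier_mat (p - j) k"
    using Utc Wtc Vc by (auto simp: E F)
  have Hc: "H \<in> carrier_mat j j" and Kc: "K \<in> carrier_mat j j"
    using Ac Bc Uc by (auto simp: H K)
  have res: "U * U\<^sup>T + Uperp * Uperp\<^sup>T = 1\<^sub>m p"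
    by (rule stiefel_complement_resolution[OF U Uperp(1) j(2)
          orthogonal_complement_transpose_mult[OF Uc Wc Uperp(2)]])
  have Vs_eq: "Vs = U * E + Uperp * F"
  proof -
    have "Vs = (U * U\<^sup>T + Uperp * Uperp\<^sup>T) * Vs" using Vc by (simp add: res)
    also have "\<dots> = U * U\<^sup>T * Vs + Uperp * Uperp\<^sup>T * Vs"
      by (rule add_mult_distrib_mat[OF mult_carrier_mat[OF Uc Utc] mult_carrier_mat[OF Wc Wtc] Vc])
    also have "\<dots> = U * E + Uperp * F"
      by (simp only: E F assoc_mult_mat[OF Uc Utc Vc] assoc_mult_mat[OF Wc Wtc Vc])
    finally show ?thesis .
  qed
  \<comment> \<open>As a norm, sin theta is nonnegative; together with sin theta < 1 this gives
    sin^2 theta < 1.\<close>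
  have s0: "0 \<le> s" using spectral_norm_nonneg by (simp add: s_def \<theta>(1))
  have s1: "s < 1" using \<theta>(2) by (simp add: s_def)
  have c: "0 < 1 - s\<^sup>2" using s0 s1 by (simp add: abs_square_less_1)
  have F_le: "vec_norm2 (F *\<^sub>v x) \<le> s * vec_norm2 x" if "x \<in> carrier_vec k" for x
    using vec_norm2_mult_mat_vec_le[of x F] that carrier_matD[OF Fc] by (simp add: s_def \<theta>(1) flip: F)
  have E_ge: "(1 - s\<^sup>2) * (vec_norm2 x)\<^sup>2 \<le> x \<bullet> ((E\<^sup>T * E) *\<^sub>v x)" if x: "x \<in> carrier_vec k" for x
  proof -
    have Vx: "Vs *\<^sub>v x \<in> carrier_vec p" using Vc x by simp
    \<comment> \<open>E x and F x are the components of Vs x along U and Uperp, and Vs preserves the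
      norm of x.\<close>
    have "(vec_norm2 x)\<^sup>2 = (vec_norm2 (E *\<^sub>v x))\<^sup>2 + (vec_norm2 (F *\<^sub>v x))\<^sup>2"
      using vec_norm2_resolution[OF Uc Wc res Vx] vec_norm2_stiefel[OF Vs x]
      by (simp add: E F assoc_mult_mat_vec[OF Utc Vc x] assoc_mult_mat_vec[OF Wtc Vc x])
    moreover have "(vec_norm2 (F *\<^sub>v x))\<^sup>2 \<le> (s * vec_norm2 x)\<^sup>2"
      using F_le[OF x] by (intro power_mono) auto
    moreover have "x \<bullet> ((E\<^sup>T * E) *\<^sub>v x) = (vec_norm2 (E *\<^sub>v x))\<^sup>2"
      using transpose_vec_mult_scalar[of "E\<^sup>T" k j "E *\<^sub>v x" x] Ec x
        assoc_mult_mat_vec[of "E\<^sup>T" k j E k x]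
      by (simp add: vec_norm2_sq)
    ultimately show ?thesis by (simp add: algebra_simps power_mult_distrib)
  qed
  have M: "pos_def_mat k (E\<^sup>T * E)"
    unfolding pos_def_mat_def
  proof (intro conjI ballI impI)
    show "sym_mat k (E\<^sup>T * E)"
      using sym_mat_congruence[of j "1\<^sub>m j" E k] Ec by (simp add: sym_mat_def)
    fix x :: "real vec" assume x: "x \<in> carrier_vec k" "x \<noteq> 0\<^sub>v k"
    then have "vec_norm2 x \<noteq> 0"
      using scalar_prod_self_eq_0_iff by (simp add: vec_norm2_def)
    then have "0 < (1 - s\<^sup>2) * (vec_norm2 x)\<^sup>2" using c by simp
    then show "0 < x \<bullet> ((E\<^sup>T * E) *\<^sub>v x)" using E_ge[OF x(1)] by linarith
  qed
  have Rc: "R \<in> carrier_mat k k"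
    using mat_sqrt_pos_def(1)[OF M] by (simp add: R pos_def_mat_def sym_mat_def)
  have Ric: "Ri \<in> carrier_mat k k" and RRi: "R * Ri = 1\<^sub>m k" and RiR: "Ri * R = 1\<^sub>m k"
    using mat_inv_sqrt_pos_def[OF M] by (auto simp: R Ri)
  have Ri_le: "vec_norm2 (Ri *\<^sub>v z) \<le> vec_norm2 z / sqrt (1 - s\<^sup>2)" if "z \<in> carrier_vec k" for z
    unfolding Ri using vec_norm2_mat_inv_sqrt_le[OF M c E_ge that] .
  have Ehat_st: "Ehat \<in> stiefel j k"
    unfolding Ehat Ri using mat_inv_sqrt_stiefel[OF Ec M] .
  then have Ehc: "Ehat \<in> carrier_mat j k" and EhE: "Ehat\<^sup>T * Ehat = 1\<^sub>m k"
    by (auto simp: stiefel_def)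
  have Ehtc: "Ehat\<^sup>T \<in> carrier_mat k j" using Ehc by simp

  \<comment> \<open>\<open>N\<close> is the bracket in the definition of \<open>G\<close>. The
    factor Ehat^T is a contraction, so it does not increase norms, and Ehat^T Ehat = I gives G Ehat
    = N; the two claims about \<open>G\<close> thus reduce to \<open>N\<close>.\<close>
  define N where "N = (\<rho> - \<rho>s) \<cdot>\<^sub>m (K * Ehat) + U\<^sup>T * C * Uperp * F * Ri"
  note UCc = mult_carrier_mat[OF Utc Cc]
  note UCWc = mult_carrier_mat[OF UCc Wc]
  note UCWFc = mult_carrier_mat[OF UCWc Fc]
  have N2c: "U\<^sup>T * C * Uperp * F * Ri \<in> carrier_mat j k"
    using mult_carrier_mat[OF UCWFc Ric] .
  then have Nc: "N \<in> carrier_mat j k"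
    by (simp add: N_def)
  have G_eq: "G = N * Ehat\<^sup>T"
    by (simp only: G N_def C_def)
  have Gc: "G \<in> carrier_mat j j"
    using Nc Ehtc by (simp add: G_eq)
  have K_vec: "K *\<^sub>v y = U\<^sup>T *\<^sub>v (B *\<^sub>v (U *\<^sub>v y))" if y: "y \<in> carrier_vec j" for y
    unfolding K using assoc_mult_mat_vec[OF mult_carrier_mat[OF Utc Bc] Uc y]
      assoc_mult_mat_vec[OF Utc Bc mult_mat_vec_carrier[OF Uc y]] by simp
  have H_vec: "H *\<^sub>v y = U\<^sup>T *\<^sub>v (A *\<^sub>v (U *\<^sub>v y))" if y: "y \<in> carrier_vec j" for y
    unfolding H using assoc_mult_mat_vec[OF mult_carrier_mat[OF Utc Ac] Uc y]
      assoc_mult_mat_vec[OF Utc Ac mult_mat_vec_carrier[OF Uc y]] by simp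
  have N_vec: "N *\<^sub>v z = (\<rho> - \<rho>s) \<cdot>\<^sub>v (K *\<^sub>v (Ehat *\<^sub>v z))
      + U\<^sup>T *\<^sub>v (C *\<^sub>v (Uperp *\<^sub>v (F *\<^sub>v (Ri *\<^sub>v z))))" if z: "z \<in> carrier_vec k" for z
  proof -
    have Riz: "Ri *\<^sub>v z \<in> carrier_vec k" using Ric z by simp
    have "N *\<^sub>v z = ((\<rho> - \<rho>s) \<cdot>\<^sub>m (K * Ehat)) *\<^sub>v z + (U\<^sup>T * C * Uperp * F * Ri) *\<^sub>v z"
      unfolding N_def using z Kc Ehc N2c by (intro add_mult_distrib_mat_vec) auto
    also have "((\<rho> - \<rho>s) \<cdot>\<^sub>m (K * Ehat)) *\<^sub>v z = (\<rho> - \<rho>s) \<cdot>\<^sub>v (K *\<^sub>v (Ehat *\<^sub>v z))"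
      by (simp only: smult_mat_mult_vec[OF mult_carrier_mat[OF Kc Ehc] z] assoc_mult_mat_vec[OF Kc Ehc z])
    also have "(U\<^sup>T * C * Uperp * F * Ri) *\<^sub>v z = U\<^sup>T *\<^sub>v (C *\<^sub>v (Uperp *\<^sub>v (F *\<^sub>v (Ri *\<^sub>v z))))"
      by (simp only: assoc_mult_mat_vec[OF UCWFc Ric z] assoc_mult_mat_vec[OF UCWc Fc Riz]
          assoc_mult_mat_vec[OF UCc Wc mult_mat_vec_carrier[OF Fc Riz]]
          assoc_mult_mat_vec[OF Utc Cc mult_mat_vec_carrier[OF Wc mult_mat_vec_carrier[OF Fc Riz]]])
    finally show ?thesis .
  qed

  \<comment> \<open>Norm bound for G\<close>
  have "spectral_norm G \<le> (\<rho>s - \<rho>) * spectral_norm B + s / sqrt (1 - s\<^sup>2) * spectral_norm C"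
  proof (rule spectral_norm_le)
    \<comment> \<open>Used twice: it makes the claimed bound nonnegative, and it turns |rho - rho*|
      into rho* - rho.\<close>
    have \<rho>_le: "\<rho> \<le> \<rho>s" using projected_trace_ratio_max_le[OF sol \<rho>] .
    then show "0 \<le> (\<rho>s - \<rho>) * spectral_norm B + s / sqrt (1 - s\<^sup>2) * spectral_norm C"
      using s0 c spectral_norm_nonneg by (intro add_nonneg_nonneg mult_nonneg_nonneg) auto
    fix x :: "real vec" assume "x \<in> carrier_vec (dim_col G)"
    then have x: "x \<in> carrier_vec j" using Gc by simp
    define z where "z = Ehat\<^sup>T *\<^sub>v x"
    have z: "z \<in> carrier_vec k" using Ehtc x by (simp add: z_def)
    have z_le: "vec_norm2 z \<le> vec_norm2 x"
      unfolding z_def using vec_norm2_stiefel_transpose[OF Ehat_st x] .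
    let ?u = "U *\<^sub>v (Ehat *\<^sub>v z)"
    let ?w = "Uperp *\<^sub>v (F *\<^sub>v (Ri *\<^sub>v z))"
    have Ez: "Ehat *\<^sub>v z \<in> carrier_vec j" using Ehc z by simp
    have u: "?u \<in> carrier_vec p" using Uc Ez by simp
    have Riz: "Ri *\<^sub>v z \<in> carrier_vec k" using Ric z by simp
    have FRiz: "F *\<^sub>v (Ri *\<^sub>v z) \<in> carrier_vec (p - j)" using Fc Riz by simp
    have w: "?w \<in> carrier_vec p" using Wc FRiz by simp
    \<comment> \<open>K is B between the contraction U^T and the isometry U, so passing from K to B
      costs nothing.\<close>
    have "vec_norm2 (K *\<^sub>v (Ehat *\<^sub>v z)) \<le> vec_norm2 (B *\<^sub>v ?u)"
      unfolding K_vec[OF Ez] using Bc u by (intro vec_norm2_stiefel_transpose[OF U]) simp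
    also have "\<dots> \<le> spectral_norm B * vec_norm2 ?u"
      using Bc u by (intro vec_norm2_mult_mat_vec_le) simp
    also have "vec_norm2 ?u = vec_norm2 z"
      using vec_norm2_stiefel[OF U Ez] vec_norm2_stiefel[OF Ehat_st z] by simp
    finally have KE: "vec_norm2 (K *\<^sub>v (Ehat *\<^sub>v z)) \<le> spectral_norm B * vec_norm2 z" .
    have "vec_norm2 (U\<^sup>T *\<^sub>v (C *\<^sub>v ?w)) \<le> vec_norm2 (C *\<^sub>v ?w)"
      using Cc w by (intro vec_norm2_stiefel_transpose[OF U]) simp
    also have "\<dots> \<le> spectral_norm C * vec_norm2 ?w"
      using Cc w by (intro vec_norm2_mult_mat_vec_le) simp
    also have "vec_norm2 ?w = vec_norm2 (F *\<^sub>v (Ri *\<^sub>v z))"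
      using vec_norm2_stiefel[OF Uperp(1) FRiz] .
    \<comment> \<open>F contributes the factor s and \<open>Ri\<close> the factor 1 / sqrt (1 -
      s^2); together they are the tangent of theta in the bound.\<close>
    also have "spectral_norm C * vec_norm2 (F *\<^sub>v (Ri *\<^sub>v z)) \<le> spectral_norm C * (s * (vec_norm2 z / sqrt (1 - s\<^sup>2)))"
      using F_le[OF Riz] mult_left_mono[OF Ri_le[OF z] s0]
      by (intro mult_left_mono spectral_norm_nonneg) linarith
    finally have CW: "vec_norm2 (U\<^sup>T *\<^sub>v (C *\<^sub>v ?w)) \<le> s / sqrt (1 - s\<^sup>2) * spectral_norm C * vec_norm2 z"
      by (simp add: mult_ac)
    have "vec_norm2 (G *\<^sub>v x) = vec_norm2 (N *\<^sub>v z)"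
      unfolding G_eq z_def using assoc_mult_mat_vec[OF Nc Ehtc x] by simp
    also have "\<dots> \<le> vec_norm2 ((\<rho> - \<rho>s) \<cdot>\<^sub>v (K *\<^sub>v (Ehat *\<^sub>v z))) + vec_norm2 (U\<^sup>T *\<^sub>v (C *\<^sub>v ?w))"
      unfolding N_vec[OF z] using Kc Ez Utc Cc w by (intro vec_norm2_add[of _ j]) auto
    also have "\<dots> \<le> (\<rho>s - \<rho>) * (spectral_norm B * vec_norm2 z) + s / sqrt (1 - s\<^sup>2) * spectral_norm C * vec_norm2 z"
      using KE CW \<rho>_le by (intro add_mono) (auto simp: vec_norm2_smult intro: mult_left_mono)
    also have "\<dots> = ((\<rho>s - \<rho>) * spectral_norm B + s / sqrt (1 - s\<^sup>2) * spectral_norm C) * vec_norm2 z"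
      by (simp add: algebra_simps)
    also have "\<dots> \<le> ((\<rho>s - \<rho>) * spectral_norm B + s / sqrt (1 - s\<^sup>2) * spectral_norm C) * vec_norm2 x"
      by (rule mult_left_mono[OF z_le]) fact
    finally show "vec_norm2 (G *\<^sub>v x)
      \<le> ((\<rho>s - \<rho>) * spectral_norm B + s / sqrt (1 - s\<^sup>2) * spectral_norm C) * vec_norm2 x" .
  qed

  \<comment> \<open>Eigenblock identity\<close>
  moreover have "(H - \<rho> \<cdot>\<^sub>m K + G) * Ehat = Ehat * (R * \<Lambda>s * Ri)"
  proof (rule mat_eqI_mult_vec[of _ j k])
    show "(H - \<rho> \<cdot>\<^sub>m K + G) * Ehat \<in> carrier_mat j k"
      using mult_carrier_mat[OF add_carrier_mat[OF Gc] Ehc] .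
    show "Ehat * (R * \<Lambda>s * Ri) \<in> carrier_mat j k"
      using mult_carrier_mat[OF Ehc mult_carrier_mat[OF mult_carrier_mat[OF Rc \<Lambda>s(1)] Ric]] .
    fix x :: "real vec" assume x: "x \<in> carrier_vec k"
    \<comment> \<open>This substitution removes the normalization: Ehat x = E y, and the claim
      becomes U^T applied to C Vs y = Vs (Lambda* y).\<close>
    define y where "y = Ri *\<^sub>v x"
    have y: "y \<in> carrier_vec k" using Ric x by (simp add: y_def)
    have Ex: "Ehat *\<^sub>v x = E *\<^sub>v y"
      unfolding Ehat y_def by (rule assoc_mult_mat_vec[OF Ec Ric x])
    have Ey: "E *\<^sub>v y \<in> carrier_vec j" using Ec y by simp
    let ?u = "U *\<^sub>v (E *\<^sub>v y)"
    let ?w = "Uperp *\<^sub>v (F *\<^sub>v y)"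
    have u: "?u \<in> carrier_vec p" and w: "?w \<in> carrier_vec p"
      using Uc Ey Wc Fc y by auto
    have Vy: "Vs *\<^sub>v y = ?u + ?w"
      unfolding Vs_eq using add_mult_distrib_mat_vec[OF mult_carrier_mat[OF Uc Ec] mult_carrier_mat[OF Wc Fc] y]
        assoc_mult_mat_vec[OF Uc Ec y] assoc_mult_mat_vec[OF Wc Fc y] by simp
    have CV: "C *\<^sub>v (?u + ?w) = Vs *\<^sub>v (\<Lambda>s *\<^sub>v y)"
      using arg_cong[OF \<Lambda>s(2), of "\<lambda>M. M *\<^sub>v y"] assoc_mult_mat_vec[OF Cc Vc y]
        assoc_mult_mat_vec[OF Vc \<Lambda>s(1) y] by (simp add: C_def Vy)
    have \<Lambda>y: "\<Lambda>s *\<^sub>v y \<in> carrier_vec k" using \<Lambda>s y by simp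
    have G_vec: "G *\<^sub>v (Ehat *\<^sub>v x) = (\<rho> - \<rho>s) \<cdot>\<^sub>v (K *\<^sub>v (E *\<^sub>v y)) + U\<^sup>T *\<^sub>v (C *\<^sub>v ?w)"
    proof -
      have "G *\<^sub>v (Ehat *\<^sub>v x) = N *\<^sub>v ((Ehat\<^sup>T * Ehat) *\<^sub>v x)"
        unfolding G_eq using assoc_mult_mat_vec[OF Nc Ehtc] assoc_mult_mat_vec[OF Ehtc Ehc x] Ehc x by simp
      then show ?thesis using x N_vec[OF x] by (simp add: EhE Ex y_def)
    qed
    have UCu: "U\<^sup>T *\<^sub>v (C *\<^sub>v ?u) = H *\<^sub>v (E *\<^sub>v y) - \<rho>s \<cdot>\<^sub>v (K *\<^sub>v (E *\<^sub>v y))"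
    proof -
      have "C *\<^sub>v ?u = A *\<^sub>v ?u - \<rho>s \<cdot>\<^sub>v (B *\<^sub>v ?u)"
        by (simp only: C_def minus_mult_distrib_mat_vec[OF Ac smult_carrier_mat[OF Bc] u] smult_mat_mult_vec[OF Bc u])
      then show ?thesis
        using mult_minus_distrib_mat_vec[OF Utc mult_mat_vec_carrier[OF Ac u]
            smult_carrier_vec[THEN iffD2, OF mult_mat_vec_carrier[OF Bc u]]]
          mult_mat_vec[OF Utc mult_mat_vec_carrier[OF Bc u]]
        by (simp only: H_vec[OF Ey] K_vec[OF Ey])
    qed
    have "((H - \<rho> \<cdot>\<^sub>m K + G) * Ehat) *\<^sub>v x = (H - \<rho> \<cdot>\<^sub>m K + G) *\<^sub>v (Ehat *\<^sub>v x)"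
      by (rule assoc_mult_mat_vec[OF add_carrier_mat[OF Gc] Ehc x])
    also have "\<dots> = (H *\<^sub>v (E *\<^sub>v y) - \<rho> \<cdot>\<^sub>v (K *\<^sub>v (E *\<^sub>v y))) + G *\<^sub>v (Ehat *\<^sub>v x)"
      by (simp only: Ex smult_mat_mult_vec[OF Kc Ey]
          add_mult_distrib_mat_vec[OF minus_carrier_mat[OF smult_carrier_mat[OF Kc]] Gc Ey]
          minus_mult_distrib_mat_vec[OF Hc smult_carrier_mat[OF Kc] Ey])
    also have "\<dots> = U\<^sup>T *\<^sub>v (C *\<^sub>v ?u) + U\<^sup>T *\<^sub>v (C *\<^sub>v ?w)"
      unfolding G_vec UCu using Hc Kc Utc by (intro eq_vecI) (auto simp: algebra_simps)
    also have "\<dots> = U\<^sup>T *\<^sub>v (C *\<^sub>v (?u + ?w))"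
      by (simp only: mult_add_distrib_mat_vec[OF Cc u w]
          mult_add_distrib_mat_vec[OF Utc mult_mat_vec_carrier[OF Cc u] mult_mat_vec_carrier[OF Cc w]])
    also have "\<dots> = E *\<^sub>v (\<Lambda>s *\<^sub>v y)"
      by (simp only: CV) (simp only: E assoc_mult_mat_vec[OF Utc Vc \<Lambda>y])
    \<comment> \<open>Inserting Ri R = I rewrites E as Ehat R, and this produces the left factor of
      the conjugated block.\<close>
    also have "\<dots> = (E * Ri) *\<^sub>v (R *\<^sub>v (\<Lambda>s *\<^sub>v y))"
      using assoc_mult_mat_vec[OF Ec Ric mult_mat_vec_carrier[OF Rc \<Lambda>y]]
        assoc_mult_mat_vec[OF Ric Rc \<Lambda>y] \<Lambda>y by (simp add: RiR)
    also have "\<dots> = (Ehat * (R * \<Lambda>s * Ri)) *\<^sub>v x"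
      using assoc_mult_mat_vec[OF Ehc mult_carrier_mat[OF mult_carrier_mat[OF Rc \<Lambda>s(1)] Ric] x]
        assoc_mult_mat_vec[OF mult_carrier_mat[OF Rc \<Lambda>s(1)] Ric x]
        assoc_mult_mat_vec[OF Rc \<Lambda>s(1) y] by (simp add: Ehat y_def)
    finally show "((H - \<rho> \<cdot>\<^sub>m K + G) * Ehat) *\<^sub>v x = (Ehat * (R * \<Lambda>s * Ri)) *\<^sub>v x" .
  qed

  moreover have "eigvals (map_mat complex_of_real (R * \<Lambda>s * Ri)) = eigvals (map_mat complex_of_real \<Lambda>s)"
  proof (rule eigvals_similar)
    show RLR: "R * \<Lambda>s * Ri \<in> carrier_mat k k" "\<Lambda>s \<in> carrier_mat k k"
      using Rc \<Lambda>s Ric by (auto intro: mult_carrier_mat)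
    show "similar_mat (R * \<Lambda>s * Ri) \<Lambda>s"
      unfolding similar_mat_def similar_mat_wit_def Let_def using RLR Rc Ric RRi RiR
      by (intro exI[of _ R] exI[of _ Ri]) auto
  qed

  ultimately show ?thesis
    using Vs_eq Ehat_st by (simp add: s_def C_def)
qed

end
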